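(* Let $\mathrm{st}:\mathfrak{S}\to\mathbb{N}$ be a permutation statistic with $\mathrm{st}(\epsilon)=0$ for which there is a function $f:\mathbb{N}^2\to\mathbb{N}$ such that for all integers $0\le k\le n$ and all $\sigma_1\in\mathfrak{S}_k(312)$, $\sigma_2\in\mathfrak{S}_{n-k}(312)$, the permutation $\sigma=213[\sigma_1,1,\sigma_2]$ satisfies $$\mathrm{st}(\sigma)=f(k,n-k)+\mathrm{st}(\sigma_1)+\mathrm{st}(\sigma_2).$$ Let $m\ge 1$, let $\pi^{(1)},\dots,\pi^{(m)}$ be $312$-avoiding permutations with block decompositions $\pi^{(j)}=\iota_{r_j}[(\pi^{(j)}_1)_*,\dots,(\pi^{(j)}_{r_j})_*]$, and let $\Pi=\{312,\pi^{(1)},\dots,\pi^{(m)}\}$. Then $F^{\mathrm{st}}_0(\Pi;q)=0$ if some $\pi^{(j)}=\epsilon$ and $F^{\mathrm{st}}_0(\Pi;q)=1$ otherwise, and for $n\ge 1$ $$F^{\mathrm{st}}_{n+1}(\Pi;q)=\sum_{k=0}^n q^{f(k,n-k)}\Bigg[\sum_{S\subseteq\{1,\dots,m\}}(-1)^{|S|}\sum_{\substack{I=(i_1,\dots,i_m):\\ 1\le i_j\le r_j-\delta_j}}F^{\mathrm{st}}_k(\underline{\Pi}_I;q)\,F^{\mathrm{st}}_{n-k}(\overline{\Pi}_{I+\delta};q)\Bigg],$$ where, for each $S$, $\delta=(\delta_1,\dots,\delta_m)$ with $\delta_j=1$ if $j\in S$ and $\delta_j=0$ if $j\notin S$.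
   Context: $\mathbb{N}$ is the set of nonnegative integers. $\mathfrak{S}_n$ is the set of permutations of $\{1,\dots,n\}$ in one-line notation, $\mathfrak{S}=\bigcup_{n\ge 0}\mathfrak{S}_n$, and $\mathfrak{S}_0=\{\epsilon\}$ with $\epsilon$ the empty permutation. A permutation $\sigma$ contains $\pi$ if some subsequence of $\sigma$ has the same relative order as $\pi$ (so every permutation contains $\epsilon$); otherwise $\sigma$ avoids $\pi$. For $\Pi\subseteq\mathfrak{S}$, $\mathfrak{S}_n(\Pi)$ is the set of $\sigma\in\mathfrak{S}_n$ avoiding every pattern in $\Pi$; $\mathfrak{S}_n(312)=\mathfrak{S}_n(\{312\})$. For a statistic $\mathrm{st}:\mathfrak{S}\to\mathbb{N}$, $F^{\mathrm{st}}_n(\Pi;q)=\sum_{\sigma\in\mathfrak{S}_n(\Pi)}q^{\mathrm{st}(\sigma)}$. For $\tau\in\mathfrak{S}_k$ and $\sigma_1,\dots,\sigma_k\in\mathfrak{S}$, the inflation $\tau[\sigma_1,\dots,\sigma_k]$ is the permutation that is a concatenation of $k$ consecutive blocks of positions, the $i$-th block (of length $|\sigma_i|$) having the relative order of $\sigma_i$ and occupying an interval of values, with the blocks' value intervals arranged relative to one another in the order of $\tau$; e.g. $213[123,1,21]=234165$. $\iota_r=12\cdots r$ is the identity of $\mathfrak{S}_r$ (and $\iota_0[\,]=\epsilon$). For $\pi\in\mathfrak{S}_m$, $\pi_*:=21[\pi,1]$, i.e. $\pi_*=(\pi(1)+1)\cdots(\pi(m)+1)\,1$; and $\pi_{i*}=(\pi_i)_*$.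 Every $312$-avoiding permutation $\pi$ can be written uniquely as $\pi=\iota_r[\pi_{1*},\dots,\pi_{r*}]$ with $r\ge 0$ and each $\pi_i$ a $312$-avoiding permutation; this is its block decomposition. For $1\le i\le r$ define $\underline{\pi}(1)=\pi_1$, $\underline{\pi}(i)=\iota_i[\pi_{1*},\dots,\pi_{i*}]$ for $i\ge 2$, and $\overline{\pi}(i)=\iota_{r-i+1}[\pi_{i*},\dots,\pi_{r*}]$ for $1\le i\le r$. For $\Pi=\{312,\pi^{(1)},\dots,\pi^{(m)}\}$ with block decompositions as in the claim and $I=(i_1,\dots,i_m)$ with $1\le i_j\le r_j$, define $$\underline{\Pi}_I=\{312,\underline{\pi^{(1)}}(i_1),\dots,\underline{\pi^{(m)}}(i_m)\},\qquad \overline{\Pi}_I=\{312,\overline{\pi^{(1)}}(i_1),\dots,\overline{\pi^{(m)}}(i_m)\}.$$ *)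

theory Defs
  imports
    "HOL-Computational_Algebra.Polynomial"
    "HOL-Combinatorics.Multiset_Permutations"
    "HOL-Library.FuncSet"
    "HOL-Library.Sublist"
begin

text \<open>
  Permutations are given in one-line notation, as lists of natural numbers; entries are
  the values \<open>1, \<dots>, n\<close>, whereas list positions are counted from 0.  The empty permutation
  is \<open>[]\<close>.
\<close>

definition perms :: "nat \<Rightarrow> nat list set" where
  "perms n = permutations_of_set {1..n}"

definition same_order :: "nat list \<Rightarrow> nat list \<Rightarrow> bool" where
  "same_order xs ys \<longleftrightarrow> length xs = length ys \<and>
     (\<forall>i < length xs. \<forall>j < length xs. xs ! i < xs ! j \<longleftrightarrow> ys ! i < ys ! j)"

definition contains :: "nat list \<Rightarrow> nat list \<Rightarrow> bool" where
  "contains \<sigma> \<pi> \<longleftrightarrow> (\<exists>xs. subseq xs \<sigma> \<and> same_order xs \<pi>)"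

definition avoiders :: "nat \<Rightarrow> nat list set \<Rightarrow> nat list set" where
  "avoiders n P = {\<sigma> \<in> perms n. \<forall>\<pi> \<in> P. \<not> contains \<sigma> \<pi>}"

definition genpoly :: "(nat list \<Rightarrow> nat) \<Rightarrow> nat \<Rightarrow> nat list set \<Rightarrow> int poly" where
  "genpoly st n P = (\<Sum>\<sigma> \<in> avoiders n P. monom 1 (st \<sigma>))"

text \<open>
  Block \<open>i\<close> of an inflation is shifted upwards by the total length of the blocks that lie
  below it, i.e. of those placed at smaller values of \<open>\<tau>\<close>.
\<close>

definition inflate :: "nat list \<Rightarrow> nat list list \<Rightarrow> nat list" where
  "inflate \<tau> \<sigma>s = concat (map
     (\<lambda>i. map ((+) (\<Sum>j | j < length \<tau> \<and> \<tau> ! j < \<tau> ! i. length (\<sigma>s ! j))) (\<sigma>s ! i))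
     [0..<length \<tau>])"

definition iota :: "nat \<Rightarrow> nat list" where
  "iota r = [1..<Suc r]"

definition star :: "nat list \<Rightarrow> nat list" where
  "star \<pi> = inflate [2, 1] [\<pi>, [1]]"

definition is_block_decomp :: "nat list \<Rightarrow> nat list list \<Rightarrow> bool" where
  "is_block_decomp \<pi> bs \<longleftrightarrow>
     (\<forall>b \<in> set bs. b \<in> avoiders (length b) {[3, 1, 2]}) \<and>
     \<pi> = inflate (iota (length bs)) (map star bs)"

lemma inflate_alt: "inflate \<tau> \<sigma>s = concat (map
     (\<lambda>i. map ((+) (\<Sum>j<length \<tau>. if \<tau> ! j < \<tau> ! i then length (\<sigma>s ! j) else 0)) (\<sigma>s ! i))
     [0..<length \<tau>])"
proof -
  have *: "{j. j < length \<tau> \<and> Q j} = {j \<in> {..<length \<tau>}. Q j}" for Q by auto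
  show ?thesis unfolding inflate_def * sum.inter_filter[OF finite_lessThan] ..
qed

lemma star_eq: "star \<pi> = map Suc \<pi> @ [1]"
  by (simp add: star_def inflate_alt numeral_eq_Suc upt_conv_Cons fun_eq_iff)

lemma inflate_iota_Nil: "inflate (iota 0) xs = []"
  by (simp add: inflate_def iota_def)

lemma inflate_iota_alt:
  "inflate (iota r) xs = concat (map (\<lambda>i. map ((+) (\<Sum>j<i. length (xs ! j))) (xs ! i)) [0..<r])"
proof -
  have *: "{j. j < r \<and> iota r ! j < iota r ! i} = {..<i}" if "i < r" for i
    using that by (auto simp: iota_def simp del: upt_Suc)
  show ?thesis unfolding inflate_def
    by (rule arg_cong[of _ _ concat], rule map_cong) (auto simp: iota_def * simp del: upt_Suc,
      use * in \<open>auto simp: iota_def simp del: upt_Suc\<close>)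
qed

lemma inflate_iota_Cons:
  "inflate (iota (Suc r)) (x # xs) = x @ map ((+) (length x)) (inflate (iota r) xs)"
  unfolding inflate_iota_alt
  by (simp add: upt_conv_Cons map_Suc_upt[symmetric] o_def map_concat sum.lessThan_Suc_shift add.assoc[symmetric]
      map_idI del: upt_Suc sum.lessThan_Suc)

lemma subseq_map_contains:
  assumes "contains xs \<pi>" "subseq (map f xs) \<sigma>" "strict_mono f"
  shows "contains \<sigma> \<pi>"
proof -
  from assms(1) obtain ys where ys: "subseq ys xs" "same_order ys \<pi>" by (auto simp: contains_def)
  have "subseq (map f ys) \<sigma>" using ys assms(2) subseq_map subseq_order.trans by blast
  moreover have "same_order (map f ys) \<pi>"
    using ys(2) strict_mono_less[OF assms(3)] by (auto simp: same_order_def)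
  ultimately show ?thesis by (auto simp: contains_def)
qed

lemma down_closed:
  fixes X :: "nat set"
  assumes "X \<subseteq> {1..n}" "\<And>x y. x \<in> X \<Longrightarrow> 1 \<le> y \<Longrightarrow> y < x \<Longrightarrow> y \<in> X"
  shows "X = {1..card X}"
proof (cases "X = {}")
  case False
  have fin: "finite X" using assms(1) finite_subset by blast
  have "X = {1..Max X}"
  proof (intro equalityI subsetI)
    fix y assume "y \<in> X" then show "y \<in> {1..Max X}" using assms(1) fin by auto
  next
    fix y assume "y \<in> {1..Max X}"
    then show "y \<in> X" using assms(2)[OF Max_in[OF fin False], of y] Max_in[OF fin False]
      by (cases "y = Max X") auto
  qed
  then show ?thesis by (metis card_atLeastAtMost diff_Suc_1)
qed auto

lemma avoiders_iff: "b \<in> avoiders n P \<longleftrightarrow> set b = {1..n} \<and> distinct b \<and> (\<forall>\<pi>\<in>P. \<not> contains b \<pi>)"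
  by (auto simp: avoiders_def perms_def permutations_of_set_def)

lemma split_312:
  assumes "\<sigma> \<in> avoiders n {[3,1,2]}" "n > 0"
  obtains k a b where "k < n" "a \<in> avoiders k {[3,1,2]}" "b \<in> avoiders (n - Suc k) {[3,1,2]}"
    "\<sigma> = star a @ map ((+) (Suc k)) b"
proof -
  have s: "set \<sigma> = {1..n}" "distinct \<sigma>" "\<not> contains \<sigma> [3,1,2]" using assms by (auto simp: avoiders_iff)
  have "1 \<in> set \<sigma>" using s assms by auto
  then obtain A B where AB: "\<sigma> = A @ 1 # B" by (meson split_list)
  have d: "1 \<notin> set A" "1 \<notin> set B" "distinct A" "distinct B" "set A \<inter> set B = {}" using s(2) AB by auto
  have lt: "x < y" if "x \<in> set A" "y \<in> set B" for x y
  proof (rule ccontr)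
    assume "\<not> x < y"
    then have yx: "y < x" using that d by (metis IntI emptyE linorder_neqE_nat)
    have "x \<in> set \<sigma>" "y \<in> set \<sigma>" using that AB by auto
    then have "1 < y" using s(1) d(2) that by (metis atLeastAtMost_iff le_neq_implies_less)
    then have so: "same_order [x, 1, y] [3,1,2]" using yx
      by (auto simp: same_order_def less_Suc_eq)
    have "subseq [x] A" "subseq [y] B" using that by (auto simp: subseq_singleton_left)
    then have "subseq ([x] @ [1] @ [y]) (A @ [1] @ B)"
      by (intro list_emb_append_mono) auto
    then show False using so s(3) AB by (auto simp: contains_def)
  qed
  define k where "k = length A"
  have len: "length \<sigma> = n" using s distinct_card by fastforce
  have un: "insert 1 (set A \<union> set B) = {1..n}" using s(1) AB by auto
  have sA1: "insert 1 (set A) = {1..card (insert 1 (set A))}"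
  proof (rule down_closed[of _ n])
    show "insert 1 (set A) \<subseteq> {1..n}" using un by blast
    fix x y assume *: "x \<in> insert 1 (set A)" "1 \<le> y" "y < x"
    have "x \<in> {1..n}" unfolding un[symmetric] using *(1) by blast
    then have "y \<in> insert 1 (set A \<union> set B)" unfolding un using *(2,3) by simp
    then show "y \<in> insert 1 (set A)" using lt[of x y] *(1-3) by (auto simp del: One_nat_def)
  qed
  have "card (insert 1 (set A)) = Suc k" using d k_def by (simp add: distinct_card)
  then have sA: "insert 1 (set A) = {1..Suc k}" using sA1 by simp
  have "set A = {1..Suc k} - {1}" unfolding sA[symmetric] using d(1) by blast
  also have "\<dots> = {2..Suc k}" by auto
  finally have setA: "set A = {2..Suc k}" .
  have kn: "k < n" using len AB k_def by simp
  have setB: "set B = {Suc (Suc k)..n}"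
  proof -
    have "set B = {1..n} - {1..Suc k}"
      unfolding un[symmetric] sA[symmetric] using d(2,5) by blast
    also have "\<dots> = {Suc (Suc k)..n}" by auto
    finally show ?thesis .
  qed
  define a where "a = map (\<lambda>x. x - 1) A"
  define b where "b = map (\<lambda>x. x - Suc k) B"
  have A: "A = map Suc a" unfolding a_def map_map using setA by (intro map_idI[symmetric]) auto
  have B: "B = map ((+) (Suc k)) b" unfolding b_def map_map using setB by (intro map_idI[symmetric]) auto
  have "set a = {1..k}"
  proof -
    have "Suc ` set a = Suc ` {1..k}" using setA A by (simp add: numeral_2_eq_2)
    then show ?thesis by (rule inj_image_eq_iff[THEN iffD1, rotated]) simp
  qed
  moreover have "set b = {1..n - Suc k}"
  proof -
    have "(+) (Suc k) ` set b = set B" using arg_cong[OF B, of set] by simp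
    also have "\<dots> = (+) (Suc k) ` {1..n - Suc k}"
      unfolding setB image_add_atLeastAtMost using kn by simp
    finally have "(+) (Suc k) ` set b = (+) (Suc k) ` {1..n - Suc k}" .
    then show ?thesis by (rule inj_image_eq_iff[THEN iffD1, rotated]) simp
  qed
  moreover have db: "distinct a" "distinct b" using A B d(3,4) distinct_map by metis+
  have "subseq (map Suc a) \<sigma>" "subseq (map ((+) (Suc k)) b) \<sigma>"
    unfolding AB A[symmetric] B[symmetric] by (auto intro: list_emb_append2)
  then have av: "\<not> contains a [3,1,2]" "\<not> contains b [3,1,2]"
    using s(3) by (auto simp: strict_mono_def dest: subseq_map_contains)
  ultimately show thesis using that[of k a b] av db kn AB A B by (simp add: avoiders_iff star_eq)
qed

lemma ex1_block_decomp:
  assumes "\<pi> \<in> avoiders n {[3, 1, 2]}"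
  shows "\<exists>!bs. is_block_decomp \<pi> bs"
proof (rule ex_ex1I)
  show "\<exists>bs. is_block_decomp \<pi> bs" using assms
  proof (induction n arbitrary: \<pi> rule: less_induct)
    case (less n)
    show ?case
    proof (cases "n = 0")
      case True
      then have "is_block_decomp \<pi> []" using less.prems
        by (simp add: is_block_decomp_def avoiders_iff inflate_iota_Nil)
      then show ?thesis by blast
    next
      case False
      then obtain k a b where *: "k < n" "a \<in> avoiders k {[3,1,2]}" "b \<in> avoiders (n - Suc k) {[3,1,2]}"
        "\<pi> = star a @ map ((+) (Suc k)) b" using split_312 less.prems by blast
      have k: "length a = k" using *(2) distinct_card[of a] by (auto simp: avoiders_iff)
      obtain bs where "is_block_decomp b bs" using less.IH[OF _ *(3)] * by auto
      then have "is_block_decomp \<pi> (a # bs)" using * k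
        by (auto simp: is_block_decomp_def inflate_iota_Cons star_eq)
      then show ?thesis by blast
    qed
  qed
next
  fix bs cs assume "is_block_decomp \<pi> bs" "is_block_decomp \<pi> cs"
  then show "bs = cs"
  proof (induction bs arbitrary: cs \<pi>)
    case Nil
    then show ?case by (cases cs) (auto simp: is_block_decomp_def inflate_iota_Nil inflate_iota_Cons star_eq)
  next
    case (Cons x bs)
    let ?Z = "\<lambda>x bs. map ((+) (Suc (length x))) (inflate (iota (length bs)) (map star bs))"
    have pi: "\<pi> = map Suc x @ 1 # ?Z x bs" using Cons.prems(1)
      by (simp add: is_block_decomp_def inflate_iota_Cons star_eq)
    then obtain y ds where cs: "cs = y # ds" using Cons.prems(2)
      by (cases cs) (auto simp: is_block_decomp_def inflate_iota_Nil)
    have pi': "\<pi> = map Suc y @ 1 # ?Z y ds" using Cons.prems(2)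
      by (simp add: cs is_block_decomp_def inflate_iota_Cons star_eq)
    have "0 \<notin> set x" "0 \<notin> set y" using Cons.prems by (auto simp: cs is_block_decomp_def avoiders_iff)
    then have "1 \<notin> set (map Suc x)" "1 \<notin> set (map Suc y)" by auto
    then have "takeWhile (\<lambda>z. z \<noteq> 1) (map Suc x @ 1 # ?Z x bs) = map Suc x"
      "takeWhile (\<lambda>z. z \<noteq> 1) (map Suc y @ 1 # ?Z y ds) = map Suc y"
      by (subst takeWhile_append2; auto)+
    then have "takeWhile (\<lambda>z. z \<noteq> 1) \<pi> = map Suc x" "takeWhile (\<lambda>z. z \<noteq> 1) \<pi> = map Suc y"
      unfolding pi[symmetric] pi'[symmetric] by this+
    then have "map Suc x = map Suc y" by simp
    moreover have "map Suc x @ 1 # ?Z x bs = map Suc y @ 1 # ?Z y ds" using pi pi' by simp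
    ultimately have "map Suc x = map Suc y \<and> ?Z x bs = ?Z y ds" by simp
    then have xy: "x = y" and Z: "?Z x bs = ?Z x ds" by (auto dest: map_injective)
    have "inflate (iota (length bs)) (map star bs) = inflate (iota (length ds)) (map star ds)"
      using Z by (rule map_injective) simp
    then have "bs = ds" using Cons.IH[of _ ds] Cons.prems by (auto simp: cs is_block_decomp_def)
    then show ?case using xy cs by simp
  qed
qed

lemma "inflate [2,1,3] [[1,2,3],[1],[2,1]] = [2,3,4,1,6,5]"
  by (simp add: inflate_alt numeral_eq_Suc upt_conv_Cons fun_eq_iff)

text \<open>
  The list \<open>[\<pi>\<^sub>1, \<dots>, \<pi>\<^sub>r]\<close> of the block decomposition of a 312-avoiding permutation;
  it is well defined by \<open>ex1_block_decomp\<close>.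
\<close>

definition blocks :: "nat list \<Rightarrow> nat list list" where
  "blocks \<pi> = (THE bs. is_block_decomp \<pi> bs)"

text \<open>
  The patterns \<open>\<pi>\<close> underlined and overlined at \<open>i\<close>, for \<open>1 \<le> i \<le> r\<close>.  In the underlined
  pattern the case \<open>i = 1\<close> is exceptional: it is \<open>\<pi>\<^sub>1\<close> itself and not its starred version.
\<close>

definition under_pat :: "nat list \<Rightarrow> nat \<Rightarrow> nat list" where
  "under_pat \<pi> i =
     (if i = 1 then blocks \<pi> ! 0 else inflate (iota i) (map star (take i (blocks \<pi>))))"

definition over_pat :: "nat list \<Rightarrow> nat \<Rightarrow> nat list" where
  "over_pat \<pi> i =
     inflate (iota (length (blocks \<pi>) - i + 1)) (map star (drop (i - 1) (blocks \<pi>)))"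

end

theory Submission
  imports Defs
begin

text \<open>
  A 312-avoiding \<open>\<sigma> = 213[a, 1, b]\<close> is the starred \<open>a\<close> followed by a copy of \<open>b\<close> above it.  A
  starred block never straddles the two parts, so \<open>\<sigma>\<close> contains \<open>\<pi>\<close>, with \<open>r\<close> blocks, iff for
  some \<open>i \<le> r\<close> the first \<open>i\<close> blocks occur in the starred \<open>a\<close> and the others in \<open>b\<close>.  Hence \<open>\<sigma>\<close>
  avoids \<open>\<pi>\<close> iff some \<open>i\<close> in \<open>{1..r}\<close> is such that \<open>a\<close> avoids the underlined and \<open>b\<close> the
  overlined pattern at \<open>i\<close>.  These \<open>i\<close> form an interval, and a nonempty interval has one more
  point than it has pairs of neighbours: this writes the indicator of avoidance as a difference
  of two sums.  The alternating sum over \<open>S\<close> arises by multiplying out over all patterns.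
\<close>

section \<open>Pattern containment in concatenations\<close>

text \<open>Vacuous if either list is empty, so a splitting with an empty part is covered as
  well.\<close>

definition below :: "nat list \<Rightarrow> nat list \<Rightarrow> bool" where
  "below xs ys \<longleftrightarrow> (\<forall>x \<in> set xs. \<forall>y \<in> set ys. x < y)"

lemma below_iff_nth: "below us vs \<longleftrightarrow> (\<forall>i<length us. \<forall>j<length vs. us ! i < vs ! j)"
  by (simp add: below_def all_set_conv_all_nth)

lemma set_mono_subseq: "subseq xs ys \<Longrightarrow> set xs \<subseteq> set ys"
  by (induction rule: list_emb.induct) auto

lemma below_subseq: "below xs ys \<Longrightarrow> subseq xs' xs \<Longrightarrow> subseq ys' ys \<Longrightarrow> below xs' ys'"
  unfolding below_def using set_mono_subseq by blast

lemma below_map_add_iff [simp]: "below (map ((+) n) xs) (map ((+) n) ys) \<longleftrightarrow> below xs ys"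
  by (simp add: below_def)

section \<open>Relative order under shifts and concatenation\<close>

lemma same_order_lengthD: "same_order xs ys \<Longrightarrow> length xs = length ys"
  by (simp add: same_order_def)

lemma same_order_less_iff:
  "same_order xs ys \<Longrightarrow> i < length xs \<Longrightarrow> j < length xs \<Longrightarrow> xs ! i < xs ! j \<longleftrightarrow> ys ! i < ys ! j"
  by (simp add: same_order_def)

lemma same_order_map_right:
  assumes "strict_mono f"
  shows "same_order xs (map f ys) \<longleftrightarrow> same_order xs ys"
  using strict_mono_less[OF assms] by (auto simp: same_order_def)

lemma same_order_map_left:
  assumes "strict_mono f"
  shows "same_order (map f xs) ys \<longleftrightarrow> same_order xs ys"
  using strict_mono_less[OF assms] by (auto simp: same_order_def)

lemma strict_mono_add_left: "strict_mono ((+) (n :: nat))"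
  by (simp add: strict_mono_def)

lemma strict_mono_Suc: "strict_mono Suc"
  by (simp add: strict_mono_def)

lemmas same_order_shift [simp] =
  same_order_map_right[OF strict_mono_add_left] same_order_map_left[OF strict_mono_add_left]
  same_order_map_right[OF strict_mono_Suc] same_order_map_left[OF strict_mono_Suc]

lemma same_order_Nil [simp]: "same_order [] ys \<longleftrightarrow> ys = []" "same_order xs [] \<longleftrightarrow> xs = []"
  by (auto simp: same_order_def)

text \<open>Equal lengths of the left parts put both cuts at the same index, so every comparison,
  within a part or across the cut, is an instance of the assumption. This cuts an occurrence along
  with its pattern.\<close>

lemma same_order_appendD:
  assumes "same_order (xs1 @ xs2) (ys1 @ ys2)" "length xs1 = length ys1"
  shows "same_order xs1 ys1" "same_order xs2 ys2" "below xs1 xs2 \<longleftrightarrow> below ys1 ys2"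
        "below xs2 xs1 \<longleftrightarrow> below ys2 ys1"
proof -
  have len2: "length xs2 = length ys2"
    using same_order_lengthD[OF assms(1)] assms(2) by simp
  note lt = same_order_less_iff[OF assms(1)]
  show "same_order xs1 ys1"
    unfolding same_order_def
  proof (intro conjI allI impI)
    fix i j assume "i < length xs1" "j < length xs1"
    then show "xs1 ! i < xs1 ! j \<longleftrightarrow> ys1 ! i < ys1 ! j"
      using lt[of i j] assms(2) by (simp add: nth_append)
  qed (use assms(2) in auto)
  show "same_order xs2 ys2"
    unfolding same_order_def
  proof (intro conjI allI impI)
    fix i j assume "i < length xs2" "j < length xs2"
    then show "xs2 ! i < xs2 ! j \<longleftrightarrow> ys2 ! i < ys2 ! j"
      using lt[of "length xs1 + i" "length xs1 + j"] assms(2) by (simp add: nth_append)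
  qed (use len2 in auto)
  have "xs1 ! i < xs2 ! j \<longleftrightarrow> ys1 ! i < ys2 ! j" "xs2 ! j < xs1 ! i \<longleftrightarrow> ys2 ! j < ys1 ! i"
    if "i < length xs1" "j < length xs2" for i j
    using that lt[of i "length xs1 + j"] lt[of "length xs1 + j" i] assms(2)
    by (simp_all add: nth_append)
  then show "below xs1 xs2 \<longleftrightarrow> below ys1 ys2" "below xs2 xs1 \<longleftrightarrow> below ys2 ys1"
    using assms(2) len2 by (auto simp: below_iff_nth)
qed

text \<open>Comparisons across the cut are forced when one part lies wholly below the other, on the
  same side in both lists.\<close>

lemma same_order_appendI:
  assumes "same_order xs1 ys1" "same_order xs2 ys2"
    and "below xs1 xs2 \<and> below ys1 ys2 \<or> below xs2 xs1 \<and> below ys2 ys1"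
  shows "same_order (xs1 @ xs2) (ys1 @ ys2)"
  unfolding same_order_def
proof (intro conjI allI impI)
  have len: "length xs1 = length ys1" "length xs2 = length ys2"
    using assms(1,2) by (auto dest: same_order_lengthD)
  then show "length (xs1 @ xs2) = length (ys1 @ ys2)" by simp
  fix i j assume ij: "i < length (xs1 @ xs2)" "j < length (xs1 @ xs2)"
  note lt = same_order_less_iff[OF assms(1)] same_order_less_iff[OF assms(2)]
  show "(xs1 @ xs2) ! i < (xs1 @ xs2) ! j \<longleftrightarrow> (ys1 @ ys2) ! i < (ys1 @ ys2) ! j"
  proof (cases "i < length xs1 \<longleftrightarrow> j < length xs1")
    case True
    then show ?thesis using ij len by (auto simp: nth_append lt)
  next
    case False
    have "(xs1 ! a < xs2 ! b \<longleftrightarrow> ys1 ! a < ys2 ! b) \<and> (xs2 ! b < xs1 ! a \<longleftrightarrow> ys2 ! b < ys1 ! a)"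
      if "a < length xs1" "b < length xs2" for a b
      using assms(3) that len by (auto simp: below_iff_nth dest: less_asym)
    then show ?thesis using False ij len
      by (cases "i < length xs1") (auto simp: nth_append)
  qed
qed

section \<open>Containment under shifts and of parts of a pattern\<close>

lemma contains_Nil [simp]: "contains \<sigma> []"
  by (auto simp: contains_def intro: exI[of _ "[]"])

lemma Nil_contains_iff [simp]: "contains [] \<pi> \<longleftrightarrow> \<pi> = []"
  by (auto simp: contains_def dest: list_emb_Nil2)

lemma contains_appendD:
  assumes "contains \<sigma> (ys1 @ ys2)"
  shows "contains \<sigma> ys1" "contains \<sigma> ys2"
proof -
  obtain xs where xs: "subseq xs \<sigma>" "same_order xs (ys1 @ ys2)"
    using assms by (auto simp: contains_def)
  define n where "n = length ys1"
  have so: "same_order (take n xs @ drop n xs) (ys1 @ ys2)" "length (take n xs) = length ys1"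
    using xs(2) same_order_lengthD[OF xs(2)] by (auto simp: n_def)
  have "subseq (take n xs @ drop n xs) \<sigma>" using xs(1) by simp
  then have "subseq (take n xs) \<sigma>" "subseq (drop n xs) \<sigma>"
    by (metis subseq_order.trans subseq_drop_many subseq_rev_drop_many subseq_order.order_refl)+
  then show "contains \<sigma> ys1" "contains \<sigma> ys2"
    using same_order_appendD(1,2)[OF so] by (auto simp: contains_def)
qed

lemma contains_map_right [simp]:
  "contains \<sigma> (map ((+) n) ys) \<longleftrightarrow> contains \<sigma> ys"
  "contains \<sigma> (map Suc ys) \<longleftrightarrow> contains \<sigma> ys"
  by (simp_all add: contains_def)

lemma contains_map_left:
  assumes "strict_mono f"
  shows "contains (map f \<sigma>) \<pi> \<longleftrightarrow> contains \<sigma> \<pi>"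
proof
  assume "contains (map f \<sigma>) \<pi>"
  then obtain xs where "subseq xs (map f \<sigma>)" "same_order xs \<pi>" by (auto simp: contains_def)
  \<comment> \<open>The positions of the occurrence, used in \<open>\<sigma>\<close> itself, pull it
    back through \<open>f\<close>.\<close>
  moreover from this obtain N where "xs = map f (nths \<sigma> N)"
    by (auto simp: subseq_conv_nths nths_map)
  ultimately show "contains \<sigma> \<pi>"
    by (auto simp: contains_def same_order_map_left[OF assms] subseq_conv_nths)
next
  assume "contains \<sigma> \<pi>"
  then show "contains (map f \<sigma>) \<pi>"
    by (rule subseq_map_contains[where f = f]) (simp_all add: assms)
qed

lemmas contains_shift [simp] =
  contains_map_left[OF strict_mono_add_left] contains_map_left[OF strict_mono_Suc]

section \<open>Sums of starred blocks\<close>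

text \<open>On block lists this inverts \<open>blocks\<close>. Taking the count from the list allows
  recursion, and initial and final segments of a block list then give the patterns that occur on the
  two sides of a cut.\<close>

definition star_sum :: "nat list list \<Rightarrow> nat list" where
  "star_sum bs = inflate (iota (length bs)) (map star bs)"

lemma star_sum_Nil [simp]: "star_sum [] = []"
  by (simp add: star_sum_def inflate_iota_Nil)

lemma length_star [simp]: "length (star b) = Suc (length b)"
  by (simp add: star_eq)

lemma star_sum_Cons: "star_sum (b # bs) = star b @ map ((+) (Suc (length b))) (star_sum bs)"
  by (simp add: star_sum_def inflate_iota_Cons)

lemma star_sum_eq_Nil_iff [simp]: "star_sum bs = [] \<longleftrightarrow> bs = []"
  by (cases bs) (auto simp: star_sum_Cons star_eq)

lemma star_sum_single: "star_sum [b] = star b"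
  by (simp add: star_sum_Cons)

lemma star_sum_append:
  "star_sum (bs @ cs) = star_sum bs @ map ((+) (length (star_sum bs))) (star_sum cs)"
  by (induction bs) (auto simp: star_sum_Cons add.assoc map_idI)

lemma star_sum_pos: "0 \<notin> set (star_sum bs)"
  by (induction bs) (auto simp: star_sum_Cons star_eq)

text \<open>Ensures that blocks shifted by this length lie above everything placed before
  them.\<close>

lemma set_star_sum_le:
  assumes "\<And>b. b \<in> set bs \<Longrightarrow> set b \<subseteq> {1..length b}"
  shows "set (star_sum bs) \<subseteq> {1..length (star_sum bs)}"
  using assms
proof (induction bs)
  case (Cons b bs)
  have "set b \<subseteq> {1..length b}" "set (star_sum bs) \<subseteq> {1..length (star_sum bs)}"
    using Cons by auto
  then show ?case by (fastforce simp: star_sum_Cons star_eq)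
qed auto

text \<open>
  A starred block ends in its minimum, so a splitting of a sum of starred blocks into a lower
  left and an upper right part cannot cut through a block.
\<close>

lemma split_star_sum:
  assumes "star_sum bs = ys1 @ ys2" "below ys1 ys2"
  obtains i where "i \<le> length bs" "ys1 = star_sum (take i bs)"
    "same_order xs ys2 \<longleftrightarrow> same_order xs (star_sum (drop i bs))"
proof -
  \<comment> \<open>\<open>ys2\<close> is only a shifted copy of the sum of the remaining blocks,
    hence its description by \<open>same_order\<close>.\<close>
  have "\<exists>i\<le>length bs. ys1 = star_sum (take i bs) \<and>
      (\<forall>xs. same_order xs ys2 \<longleftrightarrow> same_order xs (star_sum (drop i bs)))"
    using assms
  proof (induction bs arbitrary: ys1 ys2)
    case (Cons b bs)
    let ?Z = "map ((+) (Suc (length b))) (star_sum bs)"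
    show ?case
    proof (cases "ys1 = []")
      case True
      then show ?thesis using Cons.prems by (intro exI[of _ 0]) auto
    next
      case False
      have eq: "map Suc b @ [1] @ ?Z = ys1 @ ys2"
        using Cons.prems(1) by (simp add: star_sum_Cons star_eq)
      \<comment> \<open>The cut falls either no later than the 1 that ends the first block, or no
        earlier than the end of \<open>map Suc b\<close>. Whenever that 1 lands in
        \<open>ys2\<close>, the entries of \<open>ys1\<close> would have to be less than 1;
        otherwise the whole first block is in \<open>ys1\<close>.\<close>
      then consider us where "map Suc b = ys1 @ us" "us @ [1] @ ?Z = ys2"
        | us where "ys1 = map Suc b @ us" "[1] @ ?Z = us @ ys2"
        by (auto simp: append_eq_append_conv2)
      then show ?thesis
      proof cases
        case 1
        obtain y where y: "y \<in> set ys1" using False by (cases ys1) auto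
        moreover have "1 \<in> set ys2" using 1(2) by auto
        ultimately have "y < 1" using Cons.prems(2) by (auto simp: below_def)
        moreover have "y \<in> set (map Suc b)" unfolding 1(1) using y by simp
        ultimately show ?thesis by auto
      next
        case 2
        show ?thesis
        proof (cases us)
          case Nil
          obtain y where y: "y \<in> set ys1" using False by (cases ys1) auto
          moreover have "1 \<in> set ys2" using 2(2) Nil by auto
          ultimately have "y < 1" using Cons.prems(2) by (auto simp: below_def)
          then show ?thesis using y 2(1) Nil by auto
        next
          case (Cons u vs)
          then have u: "u = 1" and Z: "?Z = vs @ ys2" using 2(2) by auto
          obtain z1 z2 where z: "star_sum bs = z1 @ z2"
            "vs = map ((+) (Suc (length b))) z1" "ys2 = map ((+) (Suc (length b))) z2"
            using Z by (auto simp: map_eq_append_conv)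
          have "below vs ys2"
            using \<open>below ys1 ys2\<close> unfolding 2(1) Cons by (simp add: below_def)
          then have "below z1 z2" by (simp add: z(2,3))
          from Cons.IH[OF z(1) this] obtain i where i: "i \<le> length bs" "z1 = star_sum (take i bs)"
            "\<forall>xs. same_order xs z2 \<longleftrightarrow> same_order xs (star_sum (drop i bs))" by blast
          then show ?thesis
            by (intro exI[of _ "Suc i"]) (simp add: 2(1) Cons u z(2,3) star_sum_Cons star_eq)
        qed
      qed
    qed
  qed auto
  then show ?thesis using that by blast
qed

text \<open>An occurrence meets \<open>A\<close> in a part below the one in \<open>B\<close>, so
  \<open>split_star_sum\<close> places the cut between two blocks. Conversely, the occurrences on
  both sides combine because the later blocks lie above the earlier ones. Cuts 0 and
  \<open>length bs\<close> put the pattern into one side only.\<close>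

lemma contains_append_star_sum_iff:
  assumes "below A B" "\<And>b. b \<in> set bs \<Longrightarrow> set b \<subseteq> {1..length b}"
  shows "contains (A @ B) (star_sum bs) \<longleftrightarrow>
    (\<exists>i\<le>length bs. contains A (star_sum (take i bs)) \<and> contains B (star_sum (drop i bs)))"
proof
  assume "contains (A @ B) (star_sum bs)"
  then obtain xs1 xs2 where xs: "subseq xs1 A" "subseq xs2 B" "same_order (xs1 @ xs2) (star_sum bs)"
    by (auto simp: contains_def subseq_append_iff)
  define ys1 ys2 where "ys1 = take (length xs1) (star_sum bs)" "ys2 = drop (length xs1) (star_sum bs)"
  have ys: "star_sum bs = ys1 @ ys2" "length xs1 = length ys1"
    using same_order_lengthD[OF xs(3)] by (auto simp: ys1_ys2_def)
  note so = same_order_appendD[OF xs(3)[unfolded ys(1)] ys(2)]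
  have "below ys1 ys2" using below_subseq[OF assms(1) xs(1,2)] so(3) by simp
  then obtain i where "i \<le> length bs" "ys1 = star_sum (take i bs)"
    "same_order xs2 ys2 \<longleftrightarrow> same_order xs2 (star_sum (drop i bs))"
    using split_star_sum[OF ys(1)] by blast
  then show "\<exists>i\<le>length bs. contains A (star_sum (take i bs)) \<and> contains B (star_sum (drop i bs))"
    using so(1,2) xs(1,2) by (auto simp: contains_def)
next
  assume "\<exists>i\<le>length bs. contains A (star_sum (take i bs)) \<and> contains B (star_sum (drop i bs))"
  then obtain i xs1 xs2 where xs: "subseq xs1 A" "same_order xs1 (star_sum (take i bs))"
    "subseq xs2 B" "same_order xs2 (star_sum (drop i bs))"
    by (auto simp: contains_def)
  let ?n = "length (star_sum (take i bs))"
  have "set (star_sum (take i bs)) \<subseteq> {1..?n}"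
    by (rule set_star_sum_le) (use assms(2) in \<open>auto dest: in_set_takeD\<close>)
  then have le: "x \<le> ?n" if "x \<in> set (star_sum (take i bs))" for x
    using that by auto
  moreover have "y > 0" if "y \<in> set (star_sum (drop i bs))" for y
    using that star_sum_pos[of "drop i bs"] by (cases "y = 0") auto
  ultimately have "below (star_sum (take i bs)) (map ((+) ?n) (star_sum (drop i bs)))"
    by (fastforce simp: below_def)
  then have "same_order (xs1 @ xs2)
      (star_sum (take i bs) @ map ((+) ?n) (star_sum (drop i bs)))"
    using below_subseq[OF assms(1) xs(1,3)] xs(2,4) by (intro same_order_appendI) auto
  also have "star_sum (take i bs) @ map ((+) ?n) (star_sum (drop i bs)) = star_sum bs"
    by (simp flip: star_sum_append)
  finally show "contains (A @ B) (star_sum bs)"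
    using xs(1,3) by (auto simp: contains_def intro!: list_emb_append_mono)
qed

text \<open>The final 1 of \<open>star a\<close> can only serve as the last entry of an occurrence,
  so deleting that last entry leaves an occurrence of \<open>b\<close> inside \<open>a\<close>;
  conversely a new minimum is appended to both.\<close>

lemma contains_star_star_iff:
  assumes "0 \<notin> set a" "0 \<notin> set b"
  shows "contains (star a) (star b) \<longleftrightarrow> contains a b"
proof
  assume "contains (star a) (star b)"
  then obtain xs1 xs2 where xs: "subseq xs1 (map Suc a)" "subseq xs2 [1]"
    "same_order (xs1 @ xs2) (map Suc b @ [1])"
    by (auto simp: contains_def star_eq subseq_append_iff)
  have "length xs2 \<le> 1" using xs(2) list_emb_length by fastforce
  have "length b \<le> length xs1" 
    using same_order_lengthD[OF xs(3)] \<open>length xs2 \<le> 1\<close> by simp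
  then have "same_order (take (length b) xs1 @ (drop (length b) xs1 @ xs2)) (map Suc b @ [1])"
    "length (take (length b) xs1) = length (map Suc b)"
    using xs(3) by (simp_all flip: append_assoc)
  from same_order_appendD(1)[OF this] have "same_order (take (length b) xs1) b" by simp
  moreover have "subseq (take (length b) xs1) (map Suc a)"
    using xs(1) by (metis append_take_drop_id subseq_order.trans subseq_rev_drop_many
        subseq_order.order_refl)
  ultimately have "contains (map Suc a) b" by (auto simp: contains_def)
  then show "contains a b" by simp
next
  assume "contains a b"
  then obtain xs where xs: "subseq xs a" "same_order xs b" by (auto simp: contains_def)
  have "0 \<notin> set xs" using xs(1) assms(1) using set_mono_subseq by blast
  then have "same_order (map Suc xs @ [1]) (map Suc b @ [1])"
    using xs(2) assms(2)
    by (intro same_order_appendI) (auto simp: below_def same_order_def intro: gr0I)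
  moreover have "subseq (map Suc xs @ [1]) (map Suc a @ [1])"
    using xs(1) by (intro list_emb_append_mono subseq_map) auto
  ultimately show "contains (star a) (star b)" unfolding contains_def star_eq by blast
qed

text \<open>The minimum of a starred permutation is its last entry, so it cannot represent an entry
  that exceeds an earlier one.\<close>

lemma contains_star_star_sum_iff:
  assumes "0 \<notin> set a" "length bs \<ge> 2" "\<And>b. b \<in> set bs \<Longrightarrow> set b \<subseteq> {1..length b}"
  shows "contains (star a) (star_sum bs) \<longleftrightarrow> contains a (star_sum bs)"
proof
  assume "contains (star a) (star_sum bs)"
  then obtain xs1 xs2 where xs: "subseq xs1 (map Suc a)" "subseq xs2 [1]"
    "same_order (xs1 @ xs2) (star_sum bs)"
    by (auto simp: contains_def star_eq subseq_append_iff)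
  have "xs2 = []"
  proof (rule ccontr)
    assume "xs2 \<noteq> []"
    then have xs2: "xs2 = [1]" using xs(2) by (auto simp: subseq_append_iff elim: list_emb.cases)
    \<comment> \<open>With at least two blocks, the last entry \<open>n + 1\<close> of the sum
      exceeds all entries of the blocks \<open>cs\<close> before the last one.\<close>
    have "bs \<noteq> []" "butlast bs \<noteq> []"
      using assms(2) by (auto simp flip: length_greater_0_conv)
    then obtain cs c where bs: "bs = cs @ [c]" "cs \<noteq> []"
      by (metis append_butlast_last_id)
    define n where "n = length (star_sum cs)"
    define zs where "zs = star_sum cs @ map ((+) n) (map Suc c)"
    have eq: "star_sum bs = zs @ [n + 1]"
      by (simp add: bs star_sum_append star_sum_single star_eq zs_def n_def)
    have len: "length xs1 = length zs"
      using same_order_lengthD[OF xs(3)] by (simp add: eq xs2)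
    \<comment> \<open>The 1 is less than all of \<open>xs1\<close>, so the entry
      \<open>n + 1\<close> that it represents would be less than all of \<open>zs\<close>.\<close>
    have "below xs2 xs1"
      using xs(1) assms(1) by (fastforce simp: xs2 below_def dest: set_mono_subseq intro: gr0I)
    then have below_zs: "below [n + 1] zs"
      using same_order_appendD(4)[OF xs(3)[unfolded eq] len] by simp
    have "set (star_sum cs) \<subseteq> {1..n}"
      unfolding n_def by (rule set_star_sum_le) (use assms(3) bs in auto)
    moreover obtain z where z: "z \<in> set (star_sum cs)"
      using bs(2) star_sum_eq_Nil_iff[of cs] by (metis ex_in_conv set_empty)
    ultimately have "z \<le> n" by auto
    moreover have "n + 1 < z" using below_zs z by (auto simp: below_def zs_def)
    ultimately show False by simp
  qed
  then have "contains (map Suc a) (star_sum bs)" using xs by (auto simp: contains_def)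
  then show "contains a (star_sum bs)" by simp
next
  assume "contains a (star_sum bs)"
  then show "contains (star a) (star_sum bs)"
    by (rule subseq_map_contains[where f = Suc])
      (simp_all add: star_eq strict_mono_Suc subseq_rev_drop_many)
qed

section \<open>The decomposition of 312-avoiding permutations\<close>

abbreviation avoiders312 :: "nat \<Rightarrow> nat list set" where
  "avoiders312 n \<equiv> avoiders n {[3, 1, 2]}"

lemma finite_avoiders [simp]: "finite (avoiders n P)"
  by (rule finite_subset[of _ "perms n"]) (auto simp: avoiders_def perms_def)

lemma length_avoiders: "\<sigma> \<in> avoiders n P \<Longrightarrow> length \<sigma> = n"
  using distinct_card[of \<sigma>] by (auto simp: avoiders_iff)

lemma set_avoiders: "\<sigma> \<in> avoiders n P \<Longrightarrow> set \<sigma> = {1..n}"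
  by (simp add: avoiders_iff)

text \<open>Connects the hypothesis on the statistic with the form produced by
  \<open>split_312\<close>.\<close>

lemma inflate_213: "inflate [2, 1, 3] [a, [1], b] = star a @ map ((+) (Suc (length a))) b"
  by (simp add: inflate_alt star_eq numeral_eq_Suc upt_conv_Cons fun_eq_iff)

lemma contains_312_iff:
  "contains \<sigma> [3, 1, 2] \<longleftrightarrow> (\<exists>x y z. subseq [x, y, z] \<sigma> \<and> y < z \<and> z < x)"
proof
  assume "contains \<sigma> [3, 1, 2]"
  then obtain xs where xs: "subseq xs \<sigma>" "same_order xs [3, 1, 2]" by (auto simp: contains_def)
  then have len: "length xs = 3" by (auto dest: same_order_lengthD)
  then obtain x y z where xyz: "xs = [x, y, z]"
    by (auto simp: numeral_eq_Suc length_Suc_conv)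
  have "y < z" "z < x"
    using same_order_less_iff[OF xs(2), of 1 2] same_order_less_iff[OF xs(2), of 2 0] by (auto simp: xyz)
  then show "\<exists>x y z. subseq [x, y, z] \<sigma> \<and> y < z \<and> z < x" using xs(1) xyz by blast
next
  assume "\<exists>x y z. subseq [x, y, z] \<sigma> \<and> y < z \<and> z < x"
  then obtain x y z where "subseq [x, y, z] \<sigma>" "y < z" "z < x" by blast
  moreover from this have "same_order [x, y, z] [3, 1, 2]"
    by (auto simp: same_order_def less_Suc_eq)
  ultimately show "contains \<sigma> [3, 1, 2]" by (auto simp: contains_def)
qed

text \<open>The largest entry of 312 comes first, so no occurrence can be cut into a nonempty lower
  left and a nonempty upper right part.\<close>

lemma append_avoids_312:
  assumes "below A B" "\<not> contains A [3, 1, 2]" "\<not> contains B [3, 1, 2]"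
  shows "\<not> contains (A @ B) [3, 1, 2]"
proof
  assume "contains (A @ B) [3, 1, 2]"
  then obtain x y z where xyz: "subseq [x, y, z] (A @ B)" "y < z" "z < x"
    unfolding contains_312_iff by blast
  then obtain us vs where uv: "[x, y, z] = us @ vs" "subseq us A" "subseq vs B"
    by (auto simp: subseq_append_iff)
  have "below us vs" using below_subseq[OF assms(1) uv(2,3)] .
  then have "us = [] \<or> vs = []"
    using uv(1) xyz(2,3) by (fastforce simp: Cons_eq_append_conv below_def)
  then have "subseq [x, y, z] A \<or> subseq [x, y, z] B" using uv by auto
  then show False
    using xyz(2,3) assms(2,3) unfolding contains_312_iff by blast
qed

text \<open>The final 1 could only represent the entry 2 of the pattern, but it is less than all
  entries before it.\<close>

lemma star_avoids_312:
  assumes "0 \<notin> set a" "\<not> contains a [3, 1, 2]"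
  shows "\<not> contains (star a) [3, 1, 2]"
proof
  assume "contains (star a) [3, 1, 2]"
  then obtain x y z us vs where xyz: "y < z" "z < x" and uv: "[x, y, z] = us @ vs"
    "subseq us (map Suc a)" "subseq vs [1]"
    unfolding contains_312_iff star_eq subseq_append_iff by blast
  have pos: "\<forall>u \<in> set us. 1 < u"
    using set_mono_subseq[OF uv(2)] assms(1) by (force intro: gr0I)
  have vs: "set vs \<subseteq> {1}" "length vs \<le> 1"
    using set_mono_subseq[OF uv(3)] list_emb_length[OF uv(3)] by auto
  have "vs = []"
  proof (rule ccontr)
    assume "vs \<noteq> []"
    then have "us = [x, y]" "vs = [z]" using uv(1) vs(2) by (auto simp: Cons_eq_append_conv)
    then show False using pos vs(1) xyz by auto
  qed
  then have "subseq [x, y, z] (map Suc a)" using uv by simp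
  then have "contains (map Suc a) [3, 1, 2]"
    using xyz unfolding contains_312_iff by blast
  then show False using assms(2) by simp
qed

lemma below_star_shift:
  assumes "a \<in> avoiders k P" "b \<in> avoiders l Q"
  shows "below (star a) (map ((+) (Suc k)) b)"
  using assms by (auto simp: below_def star_eq avoiders_iff)

lemma glue_avoiders312:
  assumes "k \<le> n" "a \<in> avoiders312 k" "b \<in> avoiders312 (n - k)"
  shows "star a @ map ((+) (Suc k)) b \<in> avoiders312 (Suc n)"
proof -
  have "\<not> contains (star a @ map ((+) (Suc k)) b) [3, 1, 2]"
    using assms by (intro append_avoids_312 star_avoids_312 below_star_shift) (auto simp: avoiders_iff)
  moreover have "set (star a @ map ((+) (Suc k)) b) = {1..Suc n}"
  proof -
    have "set (star a) = {1..Suc k}"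
      using assms(2) by (auto simp: star_eq set_avoiders image_Suc_atLeastAtMost)
    moreover have "set (map ((+) (Suc k)) b) = {Suc k + 1..Suc k + (n - k)}"
      unfolding set_map set_avoiders[OF assms(3)] image_add_atLeastAtMost by (simp only: add.commute)
    ultimately show ?thesis using assms(1) by auto
  qed
  moreover have "distinct (star a @ map ((+) (Suc k)) b)"
    using assms(2,3) by (auto simp: star_eq avoiders_iff distinct_map)
  ultimately show ?thesis by (simp add: avoiders_iff)
qed

text \<open>Reindexing by \<open>\<sigma> = 213[a, 1, b]\<close>: \<open>split_312\<close> gives
  surjectivity, and the position of the entry 1 determines \<open>a\<close>, \<open>b\<close> and
  \<open>k\<close>.\<close>

lemma sum_avoiders312_Suc:
  fixes g :: "nat list \<Rightarrow> 'a :: comm_monoid_add"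
  shows "(\<Sum>\<sigma> \<in> avoiders312 (Suc n). g \<sigma>) =
    (\<Sum>k = 0..n. \<Sum>a \<in> avoiders312 k. \<Sum>b \<in> avoiders312 (n - k). g (star a @ map ((+) (Suc k)) b))"
proof -
  define h where "h = (\<lambda>(k, a, b). star a @ map ((+) (Suc k)) b)"
  define D where "D = (SIGMA k : {0..n}. avoiders312 k \<times> avoiders312 (n - k))"
  have "bij_betw h D (avoiders312 (Suc n))"
    unfolding bij_betw_def
  proof
    show "inj_on h D"
    proof (rule inj_onI)
      fix p q assume pq: "p \<in> D" "q \<in> D" "h p = h q"
      obtain k a b l c d where [simp]: "p = (k, a, b)" "q = (l, c, d)"
        by (metis prod.exhaust)
      have D: "a \<in> avoiders312 k" "c \<in> avoiders312 l" "b \<in> avoiders312 (n - k)"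
        using pq(1,2) by (auto simp: D_def)
      have glue: "map Suc a @ 1 # map ((+) (Suc k)) b = map Suc c @ 1 # map ((+) (Suc l)) d"
        using pq(3) by (simp add: h_def star_eq)
      have notin: "1 \<notin> set (map Suc a)" "1 \<notin> set (map ((+) (Suc k)) b)"
        using set_avoiders[OF D(1)] set_avoiders[OF D(3)] by auto
      have bd: "map ((+) (Suc k)) b = map ((+) (Suc l)) d" and "map Suc a = map Suc c"
        using glue unfolding append_Cons_eq_iff[OF notin] by simp_all
      then have "a = c" by (auto dest: map_injective)
      moreover from this have "k = l" using length_avoiders D(1,2) by metis
      ultimately show "p = q" using bd by (auto dest: map_injective)
    qed
    show "h ` D = avoiders312 (Suc n)"
    proof (intro equalityI subsetI)
      fix \<sigma> assume "\<sigma> \<in> h ` D"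
      then show "\<sigma> \<in> avoiders312 (Suc n)" using glue_avoiders312 by (auto simp: h_def D_def)
    next
      fix \<sigma> assume "\<sigma> \<in> avoiders312 (Suc n)"
      then obtain k a b where "k < Suc n" "a \<in> avoiders312 k" "b \<in> avoiders312 (Suc n - Suc k)"
        "\<sigma> = star a @ map ((+) (Suc k)) b" by (rule split_312) simp
      then show "\<sigma> \<in> h ` D" by (intro image_eqI[of _ _ "(k, a, b)"]) (auto simp: h_def D_def)
    qed
  qed
  from sum.reindex_bij_betw[OF this, of g, symmetric] show ?thesis
    by (simp add: D_def h_def sum.Sigma sum.cartesian_product split_def)
qed

section \<open>Avoidance in terms of underlined and overlined patterns\<close>

text \<open>
  The first sum counts the integer points of an interval and the second one the unit steps
  between them.
\<close>

lemma count_points_minus_steps: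
  fixes Q R :: "nat \<Rightarrow> bool"
  assumes Q: "\<And>i j. i \<le> j \<Longrightarrow> j \<le> r \<Longrightarrow> Q j \<Longrightarrow> Q i" and R: "\<And>i j. i \<le> j \<Longrightarrow> j \<le> r \<Longrightarrow> R i \<Longrightarrow> R j"
    and "Q 0" "R r"
  shows "(\<Sum>i = 1..r. of_bool (\<not> Q i) * of_bool (\<not> R (i - 1))) -
      (\<Sum>i = 1..r - 1. of_bool (\<not> Q i) * of_bool (\<not> R i)) =
      (of_bool (\<forall>i\<le>r. \<not> (Q i \<and> R i)) :: 'a :: comm_ring_1)"
proof -
  \<comment> \<open>\<open>R\<close> holds exactly from \<open>i0\<close> on, so for
    \<open>i \<ge> 1\<close> the conditions \<open>\<not> R (i - 1)\<close> and
    \<open>\<not> R i\<close> differ only at \<open>i = i0\<close>, and a single term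
    survives.\<close>
  define i0 where "i0 = (LEAST i. R i)"
  have i0: "R i0" "i0 \<le> r"
    unfolding i0_def using \<open>R r\<close> by (rule LeastI Least_le)+
  have R_iff: "R i \<longleftrightarrow> i0 \<le> i" if "i \<le> r" for i
    using R[OF _ that i0(1)] Least_le[of R i] by (auto simp: i0_def)
  \<comment> \<open>The added term at \<open>i = r\<close> vanishes because \<open>R r\<close>
    holds.\<close>
  have "(\<Sum>i = 1..r - 1. of_bool (\<not> Q i) * of_bool (\<not> R i)) =
      (\<Sum>i = 1..r. of_bool (\<not> Q i) * (of_bool (\<not> R i) :: 'a))"
    by (rule sum.mono_neutral_left) (use \<open>i0 \<le> r\<close> in \<open>auto simp: R_iff\<close>)
  then have "(\<Sum>i = 1..r. of_bool (\<not> Q i) * of_bool (\<not> R (i - 1))) -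
      (\<Sum>i = 1..r - 1. of_bool (\<not> Q i) * of_bool (\<not> R i)) =
      (\<Sum>i = 1..r. of_bool (\<not> Q i) * (of_bool (\<not> R (i - 1)) - of_bool (\<not> R i)) :: 'a)"
    by (simp add: sum_subtractf right_diff_distrib)
  also have "\<dots> = (\<Sum>i = 1..r. if i = i0 then of_bool (\<not> Q i) else 0)"
    by (rule sum.cong) (auto simp: R_iff)
  also have "\<dots> = of_bool (i0 \<noteq> 0 \<and> \<not> Q i0)"
    using i0 by auto
  \<comment> \<open>A common index is at least \<open>i0\<close>, so \<open>Q\<close> descends to
    \<open>i0\<close>; for \<open>i0 = 0\<close> the index 0 is common.\<close>
  also have "i0 \<noteq> 0 \<and> \<not> Q i0 \<longleftrightarrow> (\<forall>i\<le>r. \<not> (Q i \<and> R i))"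
    using R_iff i0 Q[of i0] \<open>Q 0\<close> by (cases "i0 = 0") auto
  finally show ?thesis .
qed

section \<open>The patterns at a cut of the block list\<close>

lemma is_block_decomp_blocks:
  assumes "\<pi> \<in> avoiders312 n"
  shows "is_block_decomp \<pi> (blocks \<pi>)"
  unfolding blocks_def by (rule theI'[OF ex1_block_decomp[OF assms]])

lemma star_sum_blocks: "\<pi> \<in> avoiders312 n \<Longrightarrow> star_sum (blocks \<pi>) = \<pi>"
  using is_block_decomp_blocks by (auto simp: is_block_decomp_def star_sum_def)

lemma set_blocks: "\<pi> \<in> avoiders312 n \<Longrightarrow> b \<in> set (blocks \<pi>) \<Longrightarrow> set b = {1..length b}"
  using is_block_decomp_blocks set_avoiders unfolding is_block_decomp_def by blast

text \<open>Testing \<open>star a\<close> instead of \<open>a\<close> absorbs the exceptional case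
  \<open>i = 1\<close>: a single starred block can use the final 1 of \<open>star a\<close>, two or
  more blocks cannot.\<close>

lemma contains_under_pat_iff:
  assumes "\<pi> \<in> avoiders312 n" "a \<in> avoiders312 k" "i \<in> {1..length (blocks \<pi>)}"
  shows "contains a (under_pat \<pi> i) \<longleftrightarrow> contains (star a) (star_sum (take i (blocks \<pi>)))"
proof (cases "i = 1")
  case True
  then obtain b bs where b: "blocks \<pi> = b # bs" using assms(3) by (cases "blocks \<pi>") auto
  have "0 \<notin> set b" using set_blocks[OF assms(1), of b] by (simp add: b)
  then show ?thesis
    using set_avoiders[OF assms(2)] contains_star_star_iff[of a b]
    by (simp add: b True under_pat_def star_sum_single)
next
  case False
  then have "contains (star a) (star_sum (take i (blocks \<pi>))) \<longleftrightarrow>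
      contains a (star_sum (take i (blocks \<pi>)))"
    using assms(3) set_avoiders[OF assms(2)] set_blocks[OF assms(1)]
    by (intro contains_star_star_sum_iff) (auto dest!: in_set_takeD)
  then show ?thesis using assms(3) False
    by (simp add: under_pat_def star_sum_def min_absorb2)
qed

text \<open>The overlined pattern at \<open>i\<close> still includes block \<open>i\<close> and so
  belongs to the cut \<open>i - 1\<close>, while the underlined one belongs to the cut
  \<open>i\<close>.\<close>

lemma over_pat_eq:
  assumes "i \<in> {1..length (blocks \<pi>)}"
  shows "over_pat \<pi> i = star_sum (drop (i - 1) (blocks \<pi>))"
proof -
  have "length (blocks \<pi>) - i + 1 = length (blocks \<pi>) - (i - 1)" using assms by auto
  then show ?thesis by (simp add: over_pat_def star_sum_def)
qed

lemma of_bool_avoids: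
  assumes "\<pi> \<in> avoiders312 l" "a \<in> avoiders312 k" "b \<in> avoiders312 n"
  defines "r \<equiv> length (blocks \<pi>)"
  shows "(of_bool (\<not> contains (star a @ map ((+) (Suc k)) b) \<pi>) :: 'a :: comm_ring_1) =
    (\<Sum>i = 1..r. of_bool (\<not> contains a (under_pat \<pi> i)) * of_bool (\<not> contains b (over_pat \<pi> i))) -
    (\<Sum>i = 1..r - 1. of_bool (\<not> contains a (under_pat \<pi> i)) *
      of_bool (\<not> contains b (over_pat \<pi> (i + 1))))"
proof -
  define bs where "bs = blocks \<pi>"
  define Q where "Q i = contains (star a) (star_sum (take i bs))" for i
  define R where "R i = contains b (star_sum (drop i bs))" for i
  have Q_mono: "Q i" if "i \<le> j" "Q j" for i j
  proof -
    have "take j bs = take i bs @ drop i (take j bs)"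
      using that(1) by (metis append_take_drop_id min.absorb1 take_take)
    then show ?thesis using that(2) contains_appendD(1) by (metis Q_def star_sum_append)
  qed
  have R_mono: "R j" if "i \<le> j" "R i" for i j
  proof -
    have "drop i bs = take (j - i) (drop i bs) @ drop j bs"
      using that(1) by (metis append_take_drop_id drop_drop le_add_diff_inverse2)
    then have "contains b (map ((+) (length (star_sum (take (j - i) (drop i bs))))) (star_sum (drop j bs)))"
      using that(2) contains_appendD(2) by (metis R_def star_sum_append)
    then show ?thesis by (simp add: R_def)
  qed
  have "contains (star a @ map ((+) (Suc k)) b) \<pi> \<longleftrightarrow> (\<exists>i\<le>r. Q i \<and> R i)"
    using contains_append_star_sum_iff[OF below_star_shift[OF assms(2,3)], of bs]
      set_blocks[OF assms(1)] star_sum_blocks[OF assms(1)]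
    by (auto simp: bs_def r_def Q_def R_def simp del: map_map)
  then have "of_bool (\<not> contains (star a @ map ((+) (Suc k)) b) \<pi>) =
      (of_bool (\<forall>i\<le>r. \<not> (Q i \<and> R i)) :: 'a)"
    by (intro arg_cong[of _ _ of_bool]) blast
  \<comment> \<open>\<open>Q 0\<close> and \<open>R r\<close> hold because the empty pattern is
    always contained. For \<open>\<pi> = []\<close> both sums are empty, as they should be.\<close>
  also have "\<dots> = (\<Sum>i = 1..r. of_bool (\<not> Q i) * of_bool (\<not> R (i - 1))) -
      (\<Sum>i = 1..r - 1. of_bool (\<not> Q i) * of_bool (\<not> R i))"
    by (rule count_points_minus_steps[symmetric])
      (use Q_mono R_mono in \<open>auto simp: Q_def R_def bs_def r_def\<close>)
  also have "(\<Sum>i = 1..r. of_bool (\<not> Q i) * of_bool (\<not> R (i - 1))) =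
      (\<Sum>i = 1..r. of_bool (\<not> contains a (under_pat \<pi> i)) * (of_bool (\<not> contains b (over_pat \<pi> i)) :: 'a))"
    by (rule sum.cong)
      (simp_all add: contains_under_pat_iff[OF assms(1,2)] over_pat_eq Q_def R_def bs_def r_def)
  also have "(\<Sum>i = 1..r - 1. of_bool (\<not> Q i) * of_bool (\<not> R i)) =
      (\<Sum>i = 1..r - 1. of_bool (\<not> contains a (under_pat \<pi> i)) *
        (of_bool (\<not> contains b (over_pat \<pi> (i + 1))) :: 'a))"
    by (rule sum.cong)
      (auto simp: contains_under_pat_iff[OF assms(1,2)] over_pat_eq Q_def R_def bs_def r_def)
  finally show ?thesis .
qed

section \<open>Generating polynomials\<close>

lemma prod_of_bool:
  "finite A \<Longrightarrow> (\<Prod>x\<in>A. of_bool (p x)) = (of_bool (\<forall>x\<in>A. p x) :: 'a :: comm_semiring_1)"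
  by (induction A rule: finite_induct) auto

text \<open>The product runs over indices rather than patterns; repeated patterns only repeat a
  factor that is 0 or 1.\<close>

lemma genpoly_insert_312:
  assumes "finite J"
  shows "genpoly st n (insert [3, 1, 2] (g ` J)) =
    (\<Sum>\<sigma> \<in> avoiders312 n. monom 1 (st \<sigma>) * (\<Prod>j\<in>J. of_bool (\<not> contains \<sigma> (g j))))"
proof -
  have eq: "avoiders n (insert [3, 1, 2] (g ` J)) =
      {\<sigma> \<in> avoiders312 n. \<forall>j\<in>J. \<not> contains \<sigma> (g j)}"
    by (auto simp: avoiders_def)
  show ?thesis
    unfolding genpoly_def eq sum.inter_filter[OF finite_avoiders]
    by (rule sum.cong) (auto simp: prod_of_bool assms)
qed

theorem theorem3p2:
  fixes st :: "nat list \<Rightarrow> nat"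
    and f :: "nat \<Rightarrow> nat \<Rightarrow> nat"
    and m :: nat
    and \<pi> :: "nat \<Rightarrow> nat list"
    and P :: "nat list set"
    and r :: "nat \<Rightarrow> nat"
  assumes st_empty: "st [] = 0"
    and st_rec: "\<And>n k \<sigma>1 \<sigma>2. k \<le> n \<Longrightarrow> \<sigma>1 \<in> avoiders k {[3, 1, 2]} \<Longrightarrow>
      \<sigma>2 \<in> avoiders (n - k) {[3, 1, 2]} \<Longrightarrow>
      st (inflate [2, 1, 3] [\<sigma>1, [1], \<sigma>2]) = f k (n - k) + st \<sigma>1 + st \<sigma>2"
    and m_pos: "m \<ge> 1"
    and \<pi>_avoids: "\<And>j. j \<in> {1..m} \<Longrightarrow> \<pi> j \<in> avoiders (length (\<pi> j)) {[3, 1, 2]}"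
  defines "P \<equiv> insert [3, 1, 2] (\<pi> ` {1..m})"
    and "r \<equiv> \<lambda>j. length (blocks (\<pi> j))"
  shows "genpoly st 0 P = (if \<exists>j \<in> {1..m}. \<pi> j = [] then 0 else 1) \<and>
    (\<forall>n \<ge> 1. genpoly st (n + 1) P =
      (\<Sum>k = 0..n. monom 1 (f k (n - k)) *
        (\<Sum>S \<in> Pow {1..m}. (-1) ^ card S *
          (let \<delta> = (\<lambda>j. if j \<in> S then 1 else 0) in
            \<Sum>I \<in> (\<Pi>\<^sub>E j \<in> {1..m}. {1..r j - \<delta> j}).
              genpoly st k (insert [3, 1, 2] ((\<lambda>j. under_pat (\<pi> j) (I j)) ` {1..m})) *
              genpoly st (n - k)
                (insert [3, 1, 2] ((\<lambda>j. over_pat (\<pi> j) (I j + \<delta> j)) ` {1..m}))))))"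
proof (intro conjI allI impI)
  \<comment> \<open>The empty permutation contains the empty pattern and no other.\<close>
  have "avoiders 0 P = (if \<exists>j \<in> {1..m}. \<pi> j = [] then {} else {[]})"
    by (auto simp: P_def avoiders_iff)
  then show "genpoly st 0 P = (if \<exists>j \<in> {1..m}. \<pi> j = [] then 0 else 1)"
    by (simp add: genpoly_def st_empty)
next
  fix n :: nat
  define \<delta> :: "nat set \<Rightarrow> nat \<Rightarrow> nat" where "\<delta> S = (\<lambda>j. if j \<in> S then 1 else 0)" for S
  define X :: "nat list \<Rightarrow> nat \<Rightarrow> nat \<Rightarrow> int poly"
    where "X a j i = of_bool (\<not> contains a (under_pat (\<pi> j) i))" for a j i
  define Y :: "nat list \<Rightarrow> nat \<Rightarrow> nat \<Rightarrow> int poly"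
    where "Y b j i = of_bool (\<not> contains b (over_pat (\<pi> j) i))" for b j i
  define \<I> where "\<I> S = (\<Pi>\<^sub>E j \<in> {1..m}. {1..r j - \<delta> S j})" for S
  have expand: "(\<Prod>j=1..m. of_bool (\<not> contains (star a @ map ((+) (Suc k)) b) (\<pi> j))) =
      (\<Sum>S \<in> Pow {1..m}. (-1) ^ card S *
        (\<Sum>I \<in> \<I> S. (\<Prod>j=1..m. X a j (I j)) * (\<Prod>j=1..m. Y b j (I j + \<delta> S j))))"
    if "a \<in> avoiders312 k" "b \<in> avoiders312 l" for a b k l
  proof -
    \<comment> \<open>\<open>?D S j\<close> depends on \<open>S\<close> only through whether
      \<open>j \<in> S\<close>; \<open>{}\<close> and \<open>{1..m}\<close> select the sum over
      points and the sum over steps.\<close>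
    let ?D = "\<lambda>S j. \<Sum>i = 1..r j - \<delta> S j. X a j i * Y b j (i + \<delta> S j)"
    have "(\<Prod>j=1..m. of_bool (\<not> contains (star a @ map ((+) (Suc k)) b) (\<pi> j))) =
        (\<Prod>j=1..m. ?D {} j - ?D {1..m} j)"
      by (rule prod.cong) (simp_all add: of_bool_avoids[OF \<pi>_avoids that] X_def Y_def \<delta>_def r_def)
    \<comment> \<open>\<open>S\<close> collects the factors from which the subtracted sum is chosen,
      whence the sign.\<close>
    also have "\<dots> = (\<Sum>S \<in> Pow {1..m}. (-1) ^ card S *
        (\<Prod>j\<in>S. ?D {1..m} j) * (\<Prod>j\<in>{1..m}-S. ?D {} j))"
      by (rule prod_diff_conv_sum) simp
    also have "\<dots> = (\<Sum>S \<in> Pow {1..m}. (-1) ^ card S * (\<Prod>j=1..m. ?D S j))"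
    proof (rule sum.cong)
      fix S assume S: "S \<in> Pow {1..m}"
      have "(\<Prod>j=1..m. ?D S j) = (\<Prod>j\<in>{1..m}-S. ?D S j) * (\<Prod>j\<in>S. ?D S j)"
        using S by (intro prod.subset_diff) auto
      also have "(\<Prod>j\<in>{1..m}-S. ?D S j) = (\<Prod>j\<in>{1..m}-S. ?D {} j)"
        by (rule prod.cong) (auto simp: \<delta>_def)
      also have "(\<Prod>j\<in>S. ?D S j) = (\<Prod>j\<in>S. ?D {1..m} j)"
        using S by (intro prod.cong) (auto simp: \<delta>_def subset_iff)
      finally show "(-1) ^ card S * (\<Prod>j\<in>S. ?D {1..m} j) * (\<Prod>j\<in>{1..m}-S. ?D {} j) =
          (-1) ^ card S * (\<Prod>j=1..m. ?D S j)"
        by (simp only: mult_ac)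
    qed simp
    \<comment> \<open>Choosing one summand in each factor amounts to choosing a tuple
      \<open>I\<close>.\<close>
    also have "\<dots> = (\<Sum>S \<in> Pow {1..m}. (-1) ^ card S *
        (\<Sum>I \<in> \<I> S. (\<Prod>j=1..m. X a j (I j)) * (\<Prod>j=1..m. Y b j (I j + \<delta> S j))))"
      by (simp add: prod_sum_PiE \<I>_def prod.distrib)
    finally show ?thesis .
  qed
  \<comment> \<open>The product of the two generating polynomials is a sum over pairs
    \<open>(a, b)\<close>; with the sums over \<open>S\<close> and \<open>I\<close> moved inside,
    \<open>expand\<close> applies to each pair.\<close>
  have inner: "(\<Sum>S \<in> Pow {1..m}. (-1) ^ card S *
      (\<Sum>I \<in> \<I> S. genpoly st k (insert [3, 1, 2] ((\<lambda>j. under_pat (\<pi> j) (I j)) ` {1..m})) *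
        genpoly st (n - k) (insert [3, 1, 2] ((\<lambda>j. over_pat (\<pi> j) (I j + \<delta> S j)) ` {1..m})))) =
      (\<Sum>a \<in> avoiders312 k. \<Sum>b \<in> avoiders312 (n - k). monom 1 (st a) * monom 1 (st b) *
        (\<Prod>j=1..m. of_bool (\<not> contains (star a @ map ((+) (Suc k)) b) (\<pi> j))))"
    (is "?L = ?R") for k
  proof -
    let ?x = "\<lambda>a I. \<Prod>j=1..m. X a j (I j)"
    let ?y = "\<lambda>b S I. \<Prod>j=1..m. Y b j (I j + \<delta> S j)"
    have "?L = (\<Sum>S \<in> Pow {1..m}. (-1) ^ card S * (\<Sum>I \<in> \<I> S.
        \<Sum>a \<in> avoiders312 k. \<Sum>b \<in> avoiders312 (n - k).
          (monom 1 (st a) * ?x a I) * (monom 1 (st b) * ?y b S I)))"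
      by (simp only: genpoly_insert_312[OF finite_atLeastAtMost] X_def Y_def sum_product)
    also have "\<dots> = (\<Sum>S \<in> Pow {1..m}. \<Sum>a \<in> avoiders312 k. \<Sum>b \<in> avoiders312 (n - k).
        (-1) ^ card S * (\<Sum>I \<in> \<I> S. (monom 1 (st a) * ?x a I) * (monom 1 (st b) * ?y b S I)))"
      by (simp only: sum.swap[of _ "avoiders312 _" "\<I> _"] sum_distrib_left)
    also have "\<dots> = (\<Sum>a \<in> avoiders312 k. \<Sum>b \<in> avoiders312 (n - k). \<Sum>S \<in> Pow {1..m}.
        (-1) ^ card S * (\<Sum>I \<in> \<I> S. (monom 1 (st a) * ?x a I) * (monom 1 (st b) * ?y b S I)))"
      by (simp only: sum.swap[of _ "avoiders312 _" "Pow _"])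
    also have "\<dots> = ?R"
    proof (intro sum.cong refl)
      fix a b assume "a \<in> avoiders312 k" "b \<in> avoiders312 (n - k)"
      from expand[OF this] show "(\<Sum>S \<in> Pow {1..m}. (-1) ^ card S *
          (\<Sum>I \<in> \<I> S. (monom 1 (st a) * ?x a I) * (monom 1 (st b) * ?y b S I))) =
          monom 1 (st a) * monom 1 (st b) *
          (\<Prod>j=1..m. of_bool (\<not> contains (star a @ map ((+) (Suc k)) b) (\<pi> j)))"
        by (simp only: sum_distrib_left mult_ac)
    qed
    finally show ?thesis .
  qed
  \<comment> \<open>Avoidance of the patterns stays a product of indicators, so that
    \<open>inner\<close>, read from right to left, finishes the computation once \<open>f\<close>
    has been factored out.\<close>
  have "genpoly st (n + 1) P = (\<Sum>k = 0..n. \<Sum>a \<in> avoiders312 k. \<Sum>b \<in> avoiders312 (n - k).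
      monom 1 (st (star a @ map ((+) (Suc k)) b)) *
      (\<Prod>j=1..m. of_bool (\<not> contains (star a @ map ((+) (Suc k)) b) (\<pi> j))))"
    by (simp only: P_def genpoly_insert_312[OF finite_atLeastAtMost] sum_avoiders312_Suc
        Suc_eq_plus1[symmetric])
  also have "\<dots> = (\<Sum>k = 0..n. monom 1 (f k (n - k)) *
      (\<Sum>a \<in> avoiders312 k. \<Sum>b \<in> avoiders312 (n - k). monom 1 (st a) * monom 1 (st b) *
        (\<Prod>j=1..m. of_bool (\<not> contains (star a @ map ((+) (Suc k)) b) (\<pi> j)))))"
  proof (rule sum.cong)
    fix k assume k: "k \<in> {0..n}"
    have "monom 1 (st (star a @ map ((+) (Suc k)) b)) =
        (monom 1 (f k (n - k)) * monom 1 (st a) * monom 1 (st b) :: int poly)"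
      if "a \<in> avoiders312 k" "b \<in> avoiders312 (n - k)" for a b
    proof -
      have "star a @ map ((+) (Suc k)) b = inflate [2, 1, 3] [a, [1], b]"
        using length_avoiders[OF that(1)] by (simp only: inflate_213)
      then show ?thesis using st_rec[OF _ that] k by (simp add: mult_monom)
    qed
    then show "(\<Sum>a \<in> avoiders312 k. \<Sum>b \<in> avoiders312 (n - k).
        monom (1 :: int) (st (star a @ map ((+) (Suc k)) b)) *
        (\<Prod>j=1..m. of_bool (\<not> contains (star a @ map ((+) (Suc k)) b) (\<pi> j)))) =
      monom 1 (f k (n - k)) *
      (\<Sum>a \<in> avoiders312 k. \<Sum>b \<in> avoiders312 (n - k). monom 1 (st a) * monom 1 (st b) *
        (\<Prod>j=1..m. of_bool (\<not> contains (star a @ map ((+) (Suc k)) b) (\<pi> j))))"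
      unfolding sum_distrib_left by (intro sum.cong refl) (simp add: mult.assoc)
  qed simp
  finally show "genpoly st (n + 1) P =
      (\<Sum>k = 0..n. monom 1 (f k (n - k)) *
        (\<Sum>S \<in> Pow {1..m}. (-1) ^ card S *
          (let \<delta> = (\<lambda>j. if j \<in> S then 1 else 0) in
            \<Sum>I \<in> (\<Pi>\<^sub>E j \<in> {1..m}. {1..r j - \<delta> j}).
              genpoly st k (insert [3, 1, 2] ((\<lambda>j. under_pat (\<pi> j) (I j)) ` {1..m})) *
              genpoly st (n - k)
                (insert [3, 1, 2] ((\<lambda>j. over_pat (\<pi> j) (I j + \<delta> j)) ` {1..m})))))"
    unfolding inner[symmetric] Let_def \<I>_def \<delta>_def .
qed

end
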